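(* Let $\omega_0\in\mathbb{R}$ and let $\mathcal{S}_{\omega_0}$ and $\mathcal{P}_{\omega_0}$ be the sets defined in the context. If the nodal balance equations are not satisfied, i.e. $(i_s,v)\notin\mathcal{P}_{\omega_0}$, then there exist no states $(\theta,\omega,i,i_T)$ (with stator currents $i_s$) and no machine inputs $u$ such that $(\theta,\omega,i,v,i_T,u)\in\mathcal{S}_{\omega_0}$. Conversely, for every $(i_s,v)\in\mathcal{P}_{\omega_0}$ there exist $(\theta,\omega,i,i_T)$ (with stator currents $i_s$) and $u$ such that $(\theta,\omega,i,v,i_T,u)\in\mathcal{S}_{\omega_0}$.
   Context: Notation. $(a,b)$ denotes stacked column vectors; $\mathrm{diag}$ denotes (block-)diagonal matrices; $\otimes$ is the Kronecker product; $\|\cdot\|$ is the Euclidean norm. $\mathrm{R}(\theta)=\begin{bmatrix}\cos\theta&-\sin\theta\\ \sin\theta&\cos\theta\end{bmatrix}$, $j=\mathrm{R}(\pi/2)$, $\mathsf{J}=\mathrm{diag}(j,0_{3\times3})\in\mathbb{R}^{5\times5}$. Sizes. There are $n_g$ generators, $n_v\ge n_g$ buses (generator $k$ is attached to bus $k$), $n_l=n_v-n_g$, and $n_t$ transmission lines. $E\in\{-1,0,1\}^{n_v\times n_t}$ is the oriented incidence matrix of the network graph (buses are nodes, lines are edges) and $\mathcal{E}=E\otimes I_2$. State and input. $x=(\theta,\omega,i,v,i_T)$, with rotor angles $\theta_k$, rotor speeds $\omega_k\in\mathbb{R}$, machine currents $i_k=(i_{s,k},i_{f,k},i_{d,k},i_{q,k})\in\mathbb{R}^5$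 ($i_{s,k}\in\mathbb{R}^2$ stator current; $i_{f,k},i_{d,k},i_{q,k}\in\mathbb{R}$), $k=1,\dots,n_g$; $i_s=(i_{s,1},\dots,i_{s,n_g})\in\mathbb{R}^{2n_g}$ is the vector of stator currents contained in $i$; bus voltages $v_k\in\mathbb{R}^2$, $k=1,\dots,n_v$; line currents $i_{T,k}\in\mathbb{R}^2$, $k=1,\dots,n_t$. The input is $u=(\tau_m,v_f)\in\mathbb{R}^{2n_g}$ (mechanical torques, excitation voltages). Parameters. $D=\mathrm{diag}(d_k)$, $d_k>0$; $R=\mathrm{diag}(R_1,\dots,R_{n_g})$ with $R_k=\mathrm{diag}(r_{s,k},r_{s,k},r_{f,k},r_{d,k},r_{q,k})$, all entries positive; $C=\mathrm{diag}(c_kI_2)$, $R_T=\mathrm{diag}(r_{T,k}I_2)$, $L_T=\mathrm{diag}(l_{T,k}I_2)$, $c_k,r_{T,k},l_{T,k}>0$. $L(\theta)=\mathrm{diag}(L_1(\theta_1),\dots,L_{n_g}(\theta_{n_g}))$ with $$L_k(\theta_k)=\begin{bmatrix} L_{s,k}(\theta_k) & L_{m,k}(\theta_k) \\ L_{m,k}(\theta_k)^\top & L_{r,k} \end{bmatrix},\quad L_{r,k}=\begin{bmatrix} l_{f,k} & l_{fd,k} & 0 \\ l_{fd,k} & l_{d,k} & 0 \\ 0 & 0 & l_{q,k} \end{bmatrix},$$ $L_{s,k}(\theta_k)=l_{s,k}I_2+\mathrm{R}(2\theta_k)\,\mathrm{diag}(l_{sa,k},-l_{sa,k})$, $L_{m,k}(\theta_k)=\mathrm{R}(\theta_k)\begin{bmatrix}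 l_{sf,k} & l_{sd,k} & 0 \\ 0 & 0 & -l_{sq,k} \end{bmatrix}$, with $l_{sa,k}\ge0$ and all other inductance constants positive. Torque and induced voltage: $\tau_{e,k}=\tfrac12 i_k^\top(L_k(\theta_k)\mathsf{J}+\mathsf{J}^\top L_k(\theta_k))i_k$ and $v_{\mathrm{ind},k}=\omega_k(L_k(\theta_k)\mathsf{J}^\top+\mathsf{J}L_k(\theta_k))i_k$; $\tau_e,v_{\mathrm{ind}}$ are the stacked vectors. Loads: the load current is $i_l(v)=Y_l(v)v$ with $Y_l(v)=\mathrm{diag}(Y_{l,1}(\|v_1\|),\dots,Y_{l,n_v}(\|v_{n_v}\|))$, $Y_{l,k}(\|v_k\|)=I_2g_k(\|v_k\|)+j\,b_k(\|v_k\|)$, $g_k:\mathbb{R}_{\ge0}\to\mathbb{R}_{\ge0}$, $b_k:\mathbb{R}_{\ge0}\to\mathbb{R}$. Selection matrices: $\mathcal{I}_f=I_{n_g}\otimes(0,0,1,0,0)$ (column), $\mathcal{I}_s=I_{n_g}\otimes\begin{bmatrix} I_2 \\ 0_{3\times2} \end{bmatrix}$, $\mathcal{I}_v^\top=[\mathcal{I}_s\;\;0_{5n_g\times2n_l}]$. $J_v=I_{n_v}\otimes j$, $J_T=I_{n_t}\otimes j$, $\mathcal{J}_g=I_{n_g}\otimes\mathsf{J}$. Steady-state set: $\mathcal{S}_{\omega_0}=\{(x,u):\rho(x,u,\omega_0)=0\}$ with $$\rho(x,u,\omega_0)=\begin{bmatrix} \omega_0\mathbf{1}_{n_g}-\omega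 \\ D \omega+\tau_e-\tau_m \\ (R+\omega_0L(\theta)\mathcal{J}_g)i-\mathcal{I}_v^\top v-\mathcal{I}_fv_f+v_{\mathrm{ind}} \\ \omega_0CJ_vv+\mathcal{I}_vi+\mathcal{E}i_T+i_l(v) \\ (R_T+\omega_0L_TJ_T)i_T-\mathcal{E}^\top v \end{bmatrix}.$$ Nodal current balance equations: with $Z_T=R_T+\omega_0J_TL_T$ (invertible) and $Y_N=Y_l(v)+\omega_0J_vC+\mathcal{E}Z_T^{-1}\mathcal{E}^\top$, $$\mathcal{P}_{\omega_0}=\{(i_s,v)\in\mathbb{R}^{2n_g}\times\mathbb{R}^{2n_v}:(-i_s,0_{2n_l})=Y_Nv\}.$$
   Formalization: The converse is stated only for ω_0 ≠ 0: for ω_0 = 0 a steady state forces r_{s,k} i_{s,k} = v_k at generator buses, which (i_s,v) ∈ P_0 does not imply (one bus, no lines, no load, i_s = 0, v = (1,1)). *)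

theory Defs
  imports Complex_Main "Jordan_Normal_Form.Gauss_Jordan_Elimination"
begin

(* Vectors and matrices are those of Jordan_Normal_Form, so all sizes are natural numbers (possibly
   0) and all indices start at 0: generator k is attached to bus k for k < n_gen. *)

section \<open>Stacked vectors, Kronecker products, rotations\<close>

definition stack_vec :: "nat \<Rightarrow> nat \<Rightarrow> (nat \<Rightarrow> real vec) \<Rightarrow> real vec" where
  "stack_vec b n f = vec (n * b) (\<lambda>m. f (m div b) $ (m mod b))"

definition nth_block :: "nat \<Rightarrow> real vec \<Rightarrow> nat \<Rightarrow> real vec" where
  "nth_block b x k = vec b (\<lambda>a. x $ (k * b + a))"

definition block_diag :: "nat \<Rightarrow> (nat \<Rightarrow> real mat) \<Rightarrow> real mat" where
  "block_diag n M = diag_block_mat (map M [0..<n])"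

definition kronecker :: "real mat \<Rightarrow> real mat \<Rightarrow> real mat" (infixl \<open>\<otimes>\<^sub>K\<close> 70) where
  "A \<otimes>\<^sub>K B = mat (dim_row A * dim_row B) (dim_col A * dim_col B)
     (\<lambda>(p, q). A $$ (p div dim_row B, q div dim_col B) * B $$ (p mod dim_row B, q mod dim_col B))"

definition euclid_norm :: "real vec \<Rightarrow> real" where
  "euclid_norm x = sqrt (x \<bullet> x)"

definition rot :: "real \<Rightarrow> real mat" where
  "rot t = mat_of_rows_list 2 [[cos t, - sin t], [sin t, cos t]]"

definition j2 :: "real mat" where
  "j2 = rot (pi / 2)"

definition J5 :: "real mat" where
  "J5 = diag_block_mat [j2, 0\<^sub>m 3 3]"


section \<open>Parameters\<close>

(* Line t < n_line joins the buses line_from t and line_to t; this pair also fixes its orientation.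
   g_load and b_load are only used at nonnegative arguments. *)
record power_system =
  n_gen :: nat
  n_bus :: nat
  n_line :: nat
  line_from :: "nat \<Rightarrow> nat"
  line_to :: "nat \<Rightarrow> nat"
  damping :: "nat \<Rightarrow> real"
  r_s :: "nat \<Rightarrow> real"
  r_f :: "nat \<Rightarrow> real"
  r_d :: "nat \<Rightarrow> real"
  r_q :: "nat \<Rightarrow> real"
  cap :: "nat \<Rightarrow> real"
  r_T :: "nat \<Rightarrow> real"
  l_T :: "nat \<Rightarrow> real"
  l_s :: "nat \<Rightarrow> real"
  l_sa :: "nat \<Rightarrow> real"
  l_sf :: "nat \<Rightarrow> real"
  l_sd :: "nat \<Rightarrow> real"
  l_sq :: "nat \<Rightarrow> real"
  l_f :: "nat \<Rightarrow> real"
  l_fd :: "nat \<Rightarrow> real"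
  l_d :: "nat \<Rightarrow> real"
  l_q :: "nat \<Rightarrow> real"
  g_load :: "nat \<Rightarrow> real \<Rightarrow> real"
  b_load :: "nat \<Rightarrow> real \<Rightarrow> real"

definition valid_power_system :: "power_system \<Rightarrow> bool" where
  "valid_power_system S \<longleftrightarrow>
     n_gen S \<le> n_bus S \<and>
     (\<forall>t < n_line S. line_from S t < n_bus S \<and> line_to S t < n_bus S \<and>
        line_from S t \<noteq> line_to S t) \<and>
     (\<forall>k < n_gen S. damping S k > 0 \<and>
        r_s S k > 0 \<and> r_f S k > 0 \<and> r_d S k > 0 \<and> r_q S k > 0 \<and>
        l_s S k > 0 \<and> l_sa S k \<ge> 0 \<and> l_sf S k > 0 \<and> l_sd S k > 0 \<and> l_sq S k > 0 \<and>
        l_f S k > 0 \<and> l_fd S k > 0 \<and> l_d S k > 0 \<and> l_q S k > 0) \<and>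
     (\<forall>k < n_bus S. cap S k > 0 \<and> (\<forall>r \<ge> 0. g_load S k r \<ge> 0)) \<and>
     (\<forall>t < n_line S. r_T S t > 0 \<and> l_T S t > 0)"

definition n_load :: "power_system \<Rightarrow> nat" where
  "n_load S = n_bus S - n_gen S"

definition incidence_mat :: "power_system \<Rightarrow> real mat" where
  "incidence_mat S = mat (n_bus S) (n_line S)
     (\<lambda>(k, t). if k = line_from S t then 1 else if k = line_to S t then - 1 else 0)"

definition incidence2 :: "power_system \<Rightarrow> real mat" where
  "incidence2 S = incidence_mat S \<otimes>\<^sub>K 1\<^sub>m 2"

definition D_mat :: "power_system \<Rightarrow> real mat" where
  "D_mat S = mat_diag (n_gen S) (damping S)"

definition R_mat :: "power_system \<Rightarrow> real mat" where
  "R_mat S = block_diag (n_gen S)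
     (\<lambda>k. mat_diag 5 (\<lambda>a. [r_s S k, r_s S k, r_f S k, r_d S k, r_q S k] ! a))"

definition C_mat :: "power_system \<Rightarrow> real mat" where
  "C_mat S = block_diag (n_bus S) (\<lambda>k. cap S k \<cdot>\<^sub>m 1\<^sub>m 2)"

definition RT_mat :: "power_system \<Rightarrow> real mat" where
  "RT_mat S = block_diag (n_line S) (\<lambda>t. r_T S t \<cdot>\<^sub>m 1\<^sub>m 2)"

definition LT_mat :: "power_system \<Rightarrow> real mat" where
  "LT_mat S = block_diag (n_line S) (\<lambda>t. l_T S t \<cdot>\<^sub>m 1\<^sub>m 2)"

definition Ls_mat :: "power_system \<Rightarrow> nat \<Rightarrow> real \<Rightarrow> real mat" where
  "Ls_mat S k th = l_s S k \<cdot>\<^sub>m 1\<^sub>m 2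
     + rot (2 * th) * mat_of_rows_list 2 [[l_sa S k, 0], [0, - l_sa S k]]"

definition Lm_mat :: "power_system \<Rightarrow> nat \<Rightarrow> real \<Rightarrow> real mat" where
  "Lm_mat S k th = rot th * mat_of_rows_list 3 [[l_sf S k, l_sd S k, 0], [0, 0, - l_sq S k]]"

definition Lr_mat :: "power_system \<Rightarrow> nat \<Rightarrow> real mat" where
  "Lr_mat S k = mat_of_rows_list 3
     [[l_f S k, l_fd S k, 0], [l_fd S k, l_d S k, 0], [0, 0, l_q S k]]"

definition Lk_mat :: "power_system \<Rightarrow> nat \<Rightarrow> real \<Rightarrow> real mat" where
  "Lk_mat S k th = four_block_mat
     (Ls_mat S k th) (Lm_mat S k th) (transpose_mat (Lm_mat S k th)) (Lr_mat S k)"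

definition L_mat :: "power_system \<Rightarrow> real vec \<Rightarrow> real mat" where
  "L_mat S \<theta> = block_diag (n_gen S) (\<lambda>k. Lk_mat S k (\<theta> $ k))"

definition Jv_mat :: "power_system \<Rightarrow> real mat" where
  "Jv_mat S = 1\<^sub>m (n_bus S) \<otimes>\<^sub>K j2"

definition JT_mat :: "power_system \<Rightarrow> real mat" where
  "JT_mat S = 1\<^sub>m (n_line S) \<otimes>\<^sub>K j2"

definition Jg_mat :: "power_system \<Rightarrow> real mat" where
  "Jg_mat S = 1\<^sub>m (n_gen S) \<otimes>\<^sub>K J5"

definition If_mat :: "power_system \<Rightarrow> real mat" where
  "If_mat S = 1\<^sub>m (n_gen S) \<otimes>\<^sub>K mat_of_rows_list 1 [[0], [0], [1], [0], [0]]"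

definition Is_mat :: "power_system \<Rightarrow> real mat" where
  "Is_mat S = 1\<^sub>m (n_gen S) \<otimes>\<^sub>K (1\<^sub>m 2 @\<^sub>r 0\<^sub>m 3 2)"

definition Iv_mat :: "power_system \<Rightarrow> real mat" where
  "Iv_mat S = transpose_mat (Is_mat S) @\<^sub>r 0\<^sub>m (2 * n_load S) (5 * n_gen S)"


section \<open>Torque, induced voltage, loads\<close>

definition torque :: "power_system \<Rightarrow> real vec \<Rightarrow> real vec \<Rightarrow> real vec" where
  "torque S \<theta> i = vec (n_gen S) (\<lambda>k.
     let L = Lk_mat S k (\<theta> $ k); ik = nth_block 5 i k
     in 1 / 2 * (ik \<bullet> ((L * J5 + transpose_mat J5 * L) *\<^sub>v ik)))"

definition v_ind :: "power_system \<Rightarrow> real vec \<Rightarrow> real vec \<Rightarrow> real vec \<Rightarrow> real vec" where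
  "v_ind S \<theta> \<omega> i = stack_vec 5 (n_gen S) (\<lambda>k.
     let L = Lk_mat S k (\<theta> $ k)
     in (\<omega> $ k) \<cdot>\<^sub>v ((L * transpose_mat J5 + J5 * L) *\<^sub>v nth_block 5 i k))"

definition stator_currents :: "power_system \<Rightarrow> real vec \<Rightarrow> real vec" where
  "stator_currents S i = stack_vec 2 (n_gen S) (\<lambda>k. vec_first (nth_block 5 i k) 2)"

definition Yl_mat :: "power_system \<Rightarrow> real vec \<Rightarrow> real mat" where
  "Yl_mat S v = block_diag (n_bus S) (\<lambda>k.
     let r = euclid_norm (nth_block 2 v k)
     in g_load S k r \<cdot>\<^sub>m 1\<^sub>m 2 + b_load S k r \<cdot>\<^sub>m j2)"

definition i_load :: "power_system \<Rightarrow> real vec \<Rightarrow> real vec" where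
  "i_load S v = Yl_mat S v *\<^sub>v v"


section \<open>Steady states and nodal current balance\<close>

type_synonym state = "real vec \<times> real vec \<times> real vec \<times> real vec \<times> real vec"
type_synonym input = "real vec \<times> real vec"

definition is_state :: "power_system \<Rightarrow> state \<Rightarrow> bool" where
  "is_state S x \<longleftrightarrow> (case x of (\<theta>, \<omega>, i, v, iT) \<Rightarrow>
     \<theta> \<in> carrier_vec (n_gen S) \<and> \<omega> \<in> carrier_vec (n_gen S) \<and>
     i \<in> carrier_vec (5 * n_gen S) \<and> v \<in> carrier_vec (2 * n_bus S) \<and>
     iT \<in> carrier_vec (2 * n_line S))"

definition is_input :: "power_system \<Rightarrow> input \<Rightarrow> bool" where
  "is_input S u \<longleftrightarrow> (case u of (\<tau>m, vf) \<Rightarrow>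
     \<tau>m \<in> carrier_vec (n_gen S) \<and> vf \<in> carrier_vec (n_gen S))"

definition rho :: "power_system \<Rightarrow> state \<Rightarrow> input \<Rightarrow> real \<Rightarrow> real vec" where
  "rho S x u \<omega>0 = (case x of (\<theta>, \<omega>, i, v, iT) \<Rightarrow> case u of (\<tau>m, vf) \<Rightarrow>
     (\<omega>0 \<cdot>\<^sub>v vec (n_gen S) (\<lambda>_. 1) - \<omega>)
     @\<^sub>v (D_mat S *\<^sub>v \<omega> + torque S \<theta> i - \<tau>m)
     @\<^sub>v ((R_mat S + \<omega>0 \<cdot>\<^sub>m (L_mat S \<theta> * Jg_mat S)) *\<^sub>v i
          - transpose_mat (Iv_mat S) *\<^sub>v v - If_mat S *\<^sub>v vf + v_ind S \<theta> \<omega> i)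
     @\<^sub>v (\<omega>0 \<cdot>\<^sub>v ((C_mat S * Jv_mat S) *\<^sub>v v) + Iv_mat S *\<^sub>v i
          + incidence2 S *\<^sub>v iT + i_load S v)
     @\<^sub>v ((RT_mat S + \<omega>0 \<cdot>\<^sub>m (LT_mat S * JT_mat S)) *\<^sub>v iT
          - transpose_mat (incidence2 S) *\<^sub>v v))"

definition rho_dim :: "power_system \<Rightarrow> nat" where
  "rho_dim S = n_gen S + (n_gen S + (5 * n_gen S + (2 * n_bus S + 2 * n_line S)))"

definition steady_states :: "power_system \<Rightarrow> real \<Rightarrow> (state \<times> input) set" where
  "steady_states S \<omega>0 =
     {(x, u). is_state S x \<and> is_input S u \<and> rho S x u \<omega>0 = 0\<^sub>v (rho_dim S)}"

definition ZT_mat :: "power_system \<Rightarrow> real \<Rightarrow> real mat" where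
  "ZT_mat S \<omega>0 = RT_mat S + \<omega>0 \<cdot>\<^sub>m (JT_mat S * LT_mat S)"

(* For w0 = 0 the stator rows of rho reduce to r_s * i_s = v at every generator bus, which the nodal
   balance equations do not imply. Hence nodal balance is sufficient for the existence of a steady
   state only if w0 is nonzero; it is necessary for every w0. *)

(* The value of mat_inverse is never None here: by positivity of the line resistances ZT_mat is
   invertible. *)
definition YN_mat :: "power_system \<Rightarrow> real \<Rightarrow> real vec \<Rightarrow> real mat" where
  "YN_mat S \<omega>0 v = Yl_mat S v + \<omega>0 \<cdot>\<^sub>m (Jv_mat S * C_mat S)
     + incidence2 S * the (mat_inverse (ZT_mat S \<omega>0)) * transpose_mat (incidence2 S)"

definition nodal_balance :: "power_system \<Rightarrow> real \<Rightarrow> (real vec \<times> real vec) set" where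
  "nodal_balance S \<omega>0 =
     {(is, v). is \<in> carrier_vec (2 * n_gen S) \<and> v \<in> carrier_vec (2 * n_bus S) \<and>
        (- is) @\<^sub>v 0\<^sub>v (2 * n_load S) = YN_mat S \<omega>0 v *\<^sub>v v}"

end

theory Submission
  imports Defs "Jordan_Normal_Form.Determinant"
begin

text \<open>At synchronous speed the last block of \<open>rho\<close> determines the line currents, because the line
  resistances make \<open>ZT_mat\<close> invertible; eliminating them turns the bus equations into the nodal
  balance equations. The bus equations involve the machines only through the stator currents, so it
  remains to solve the machine equations for prescribed stator currents and bus voltages. The terms
  with \<open>L J\<close> cancel, leaving \<open>R i + w J L i\<close>. In complex notation, with stator current \<open>z\<close>, the
  stator rows then require \<open>l_sa e\<^bsup>2i\<theta>\<^esup> z\<^sup>* + l_sf e\<^bsup>i\<theta>\<^esup> f = p\<close> for a prescribed complex number \<open>p\<close>.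
  Choosing \<open>\<theta>\<close> as the argument of \<open>l_sa z + p\<close> makes the required field current \<open>f\<close> real.\<close>

section \<open>Block-diagonal matrices acting blockwise\<close>

lemma block_index_less:
  fixes a b k n :: nat
  assumes "k < n" "a < b"
  shows "k * b + a < n * b"
proof -
  have "k * b + a < Suc k * b" using assms by simp
  also have "\<dots> \<le> n * b" using assms by (intro mult_le_mono1) simp
  finally show ?thesis .
qed

lemma block_of_index:
  fixes b n p :: nat
  assumes "p < n * b"
  shows "p div b < n" "p mod b < b" "p = p div b * b + p mod b"
proof -
  have "b > 0" using assms by (cases b) auto
  then show "p div b < n" "p mod b < b" "p = p div b * b + p mod b"
    using assms by (auto simp: less_mult_imp_div_less)
qed

lemma dim_nth_block [simp]: "dim_vec (nth_block b x k) = b"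
  by (simp add: nth_block_def)

lemma nth_block_carrier [simp]: "nth_block b x k \<in> carrier_vec b"
  by (simp add: nth_block_def)

lemma index_nth_block [simp]: "a < b \<Longrightarrow> nth_block b x k $ a = x $ (k * b + a)"
  by (simp add: nth_block_def)

text \<open>Lets equations between stacked vectors be checked one generator, bus or line at a
  time.\<close>

lemma vec_eq_blocksI:
  assumes "x \<in> carrier_vec (n * b)" "y \<in> carrier_vec (n * b)"
    and "\<And>k. k < n \<Longrightarrow> nth_block b x k = nth_block b y k"
  shows "x = y"
proof (rule eq_vecI)
  fix p assume "p < dim_vec y"
  then have p: "p < n * b" using assms(2) by simp
  note q = block_of_index[OF p]
  have "x $ p = nth_block b x (p div b) $ (p mod b)" using q by simp
  also have "\<dots> = nth_block b y (p div b) $ (p mod b)" using assms(3) q by simp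
  also have "\<dots> = y $ p" using q by simp
  finally show "x $ p = y $ p" .
qed (use assms in auto)

lemma mult_mat_vec_index:
  assumes "A \<in> carrier_mat m n" "x \<in> carrier_vec n" "p < m"
  shows "(A *\<^sub>v x) $ p = (\<Sum>q<n. A $$ (p, q) * x $ q)"
  using assms by (auto simp: scalar_prod_def atLeast0LessThan intro!: sum.cong)

text \<open>\<open>diag_block_mat\<close> recurses over a list of blocks of arbitrary sizes. For
  blocks of one common size, quotient and remainder of an index give the block and the position in
  it. The induction splits off the last block.\<close>

lemma block_diag_eq_mat:
  assumes "\<forall>k<n. M k \<in> carrier_mat b c"
  shows "block_diag n M = mat (n * b) (n * c)
    (\<lambda>(p, q). if p div b = q div c then M (p div b) $$ (p mod b, q mod c) else 0)"
  using assms
proof (induction n)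
  case 0
  then show ?case by (intro eq_matI) (auto simp: block_diag_def)
next
  case (Suc n)
  let ?B = "mat (n * b) (n * c)
    (\<lambda>(p, q). if p div b = q div c then M (p div b) $$ (p mod b, q mod c) else 0)"
  have IH: "diag_block_mat (map M [0..<n]) = ?B"
    using Suc by (simp add: block_diag_def)
  have M: "M n \<in> carrier_mat b c" using Suc by simp
  \<comment> \<open>Indices past the first n blocks lie in block n, because they stay below (n + 1)
    * d.\<close>
  have last: "p div d = n \<and> p mod d = p - n * d" if "n * d \<le> p" "p < d + n * d" for p d :: nat
  proof -
    have "p div d = n"
      using that by (intro div_nat_eqI) (auto simp: mult.commute)
    then show ?thesis by (simp add: minus_div_mult_eq_mod[symmetric])
  qed
  have "block_diag (Suc n) M = four_block_mat ?B (0\<^sub>m (n * b) c) (0\<^sub>m b (n * c)) (M n)"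
    using M by (simp add: block_diag_def diag_block_mat_last IH Let_def)
  also have "\<dots> = mat (Suc n * b) (Suc n * c)
    (\<lambda>(p, q). if p div b = q div c then M (p div b) $$ (p mod b, q mod c) else 0)"
  proof (rule eq_matI, goal_cases)
    case (1 p q)
    then have pq: "p < b + n * b" "q < c + n * c" by auto
    have "q < n * c \<Longrightarrow> q div c < n" "p < n * b \<Longrightarrow> p div b < n"
      using block_of_index by auto
    then show ?case
      using pq M last[of b p] last[of c q]
      by (cases "p < n * b"; cases "q < n * c") auto
  qed (use M in auto)
  finally show ?case .
qed

lemma block_diag_carrier:
  assumes "\<forall>k<n. M k \<in> carrier_mat b c"
  shows "block_diag n M \<in> carrier_mat (n * b) (n * c)"
  by (simp add: block_diag_eq_mat[of n M b c, OF assms])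

lemma block_diag_cong:
  "(\<And>k. k < n \<Longrightarrow> M k = N k) \<Longrightarrow> block_diag n M = block_diag n N"
  by (auto simp: block_diag_def intro!: arg_cong[of _ _ diag_block_mat])

text \<open>Brings \<open>Jv_mat\<close>, \<open>JT_mat\<close>, \<open>Jg_mat\<close>,
  \<open>Is_mat\<close> and \<open>If_mat\<close> into the block-diagonal form that the parameter
  matrices already have, so one calculus serves all of them.\<close>

lemma kronecker_one_eq_block_diag:
  "1\<^sub>m n \<otimes>\<^sub>K B = block_diag n (\<lambda>_. B)"
proof -
  have "block_diag n (\<lambda>_. B) = mat (n * dim_row B) (n * dim_col B)
    (\<lambda>(p, q). if p div dim_row B = q div dim_col B
       then B $$ (p mod dim_row B, q mod dim_col B) else 0)"
    by (rule block_diag_eq_mat) auto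
  also have "\<dots> = 1\<^sub>m n \<otimes>\<^sub>K B"
    by (rule eq_matI) (auto simp: kronecker_def block_of_index)
  finally show ?thesis by simp
qed

text \<open>In row k * b + a only the columns from k * c up to k * c + c can carry nonzero entries.
  Restricting the sum to this interval and shifting it to start at 0 leaves a row of
  \<open>M k\<close>.\<close>

lemma nth_block_block_diag_mult:
  assumes M: "\<forall>k<n. M k \<in> carrier_mat b c"
    and x: "x \<in> carrier_vec (n * c)" and k: "k < n"
  shows "nth_block b (block_diag n M *\<^sub>v x) k = M k *\<^sub>v nth_block c x k"
proof (rule eq_vecI)
  fix a assume "a < dim_vec (M k *\<^sub>v nth_block c x k)"
  then have a: "a < b" using M k by auto
  have p: "k * b + a < n * b" using block_index_less[OF k a] .
  have sub: "{k * c..<k * c + c} \<subseteq> {..<n * c}"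
  proof
    fix q assume "q \<in> {k * c..<k * c + c}"
    then have "q - k * c < c" "q = k * c + (q - k * c)" by auto
    then show "q \<in> {..<n * c}" using block_index_less[OF k, of "q - k * c" c] by simp
  qed
  have idiv: "i div c = k" if "k * c \<le> i" "i < k * c + c" for i
    using that by (intro div_nat_eqI) (auto simp: mult.commute)
  have "(block_diag n M *\<^sub>v x) $ (k * b + a)
      = (\<Sum>q<n * c. block_diag n M $$ (k * b + a, q) * x $ q)"
    using block_diag_carrier[OF M] x p by (intro mult_mat_vec_index) auto
  also have "\<dots> = (\<Sum>q<n * c. if k = q div c then M k $$ (a, q mod c) * x $ q else 0)"
    using a p by (intro sum.cong) (auto simp: block_diag_eq_mat[of n M b c, OF M])
  also have "\<dots> = (\<Sum>q\<in>{k * c..<k * c + c}. M k $$ (a, q mod c) * x $ q)"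
  proof (rule sum.mono_neutral_cong_right)
    show "\<forall>i\<in>{..<n * c} - {k * c..<k * c + c}.
            (if k = i div c then M k $$ (a, i mod c) * x $ i else 0) = 0"
    proof
      fix i assume i: "i \<in> {..<n * c} - {k * c..<k * c + c}"
      then have "i < n * c" by simp
      note q = block_of_index[OF this]
      have "k \<noteq> i div c"
      proof
        assume "k = i div c"
        then have "i \<in> {k * c..<k * c + c}" using q(2,3) by (metis atLeastLessThan_iff le_add1 nat_add_left_cancel_less)
        with i show False by simp
      qed
      then show "(if k = i div c then M k $$ (a, i mod c) * x $ i else 0) = 0" by simp
    qed
    fix i assume i: "i \<in> {k * c..<k * c + c}"
    then show "(if k = i div c then M k $$ (a, i mod c) * x $ i else 0) = M k $$ (a, i mod c) * x $ i"
      using idiv by simp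
  qed (use sub in auto)
  also have "\<dots> = (\<Sum>q<c. M k $$ (a, q) * x $ (k * c + q))"
    by (rule sum.reindex_bij_witness[of _ "\<lambda>q. k * c + q" "\<lambda>q. q - k * c"])
       (auto simp: less_diff_conv2 minus_div_mult_eq_mod[symmetric] idiv)
  also have "\<dots> = (\<Sum>q<c. M k $$ (a, q) * nth_block c x k $ q)"
    by simp
  also have "\<dots> = (M k *\<^sub>v nth_block c x k) $ a"
    using M k a by (intro mult_mat_vec_index[symmetric]) auto
  finally show "nth_block b (block_diag n M *\<^sub>v x) k $ a = (M k *\<^sub>v nth_block c x k) $ a"
    using a by simp
qed (use M k in auto)

text \<open>Evaluation at unit vectors recovers the entries. Identities between block-diagonal
  matrices thereby reduce to their blockwise action.\<close>

lemma mat_eq_mult_vecI: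
  fixes A B :: "real mat"
  assumes A: "A \<in> carrier_mat m n" and B: "B \<in> carrier_mat m n"
    and eq: "\<And>x. x \<in> carrier_vec n \<Longrightarrow> A *\<^sub>v x = B *\<^sub>v x"
  shows "A = B"
proof (rule eq_matI)
  fix p q assume pq: "p < dim_row B" "q < dim_col B"
  have *: "(X *\<^sub>v unit_vec n q) $ p = X $$ (p, q)" if "X \<in> carrier_mat m n" for X :: "real mat"
    using that pq B by auto
  show "A $$ (p, q) = B $$ (p, q)"
    using eq[of "unit_vec n q"] *[OF A] *[OF B] by simp
qed (use A B in auto)

lemma block_diag_mult_block_diag:
  assumes M: "\<forall>k<n. M k \<in> carrier_mat b c"
    and N: "\<forall>k<n. N k \<in> carrier_mat c d"
  shows "block_diag n M * block_diag n N = block_diag n (\<lambda>k. M k * N k)"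
proof (rule mat_eq_mult_vecI)
  note C = block_diag_carrier[of n M b c, OF M] block_diag_carrier[of n N c d, OF N]
  have MN: "\<forall>k<n. M k * N k \<in> carrier_mat b d" using M N by (auto intro: mult_carrier_mat)
  show "block_diag n M * block_diag n N \<in> carrier_mat (n * b) (n * d)" using C by simp
  show D: "block_diag n (\<lambda>k. M k * N k) \<in> carrier_mat (n * b) (n * d)"
    using block_diag_carrier[of n "\<lambda>k. M k * N k", OF MN] .
  fix x :: "real vec" assume x: "x \<in> carrier_vec (n * d)"
  have Nx: "block_diag n N *\<^sub>v x \<in> carrier_vec (n * c)" using C x by auto
  have "block_diag n M *\<^sub>v (block_diag n N *\<^sub>v x) = block_diag n (\<lambda>k. M k * N k) *\<^sub>v x"
  proof (rule vec_eq_blocksI)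
    fix k assume k: "k < n"
    show "nth_block b (block_diag n M *\<^sub>v (block_diag n N *\<^sub>v x)) k
      = nth_block b (block_diag n (\<lambda>k. M k * N k) *\<^sub>v x) k"
      unfolding nth_block_block_diag_mult[of n M, OF M Nx k]
        nth_block_block_diag_mult[of n N, OF N x k]
        nth_block_block_diag_mult[of n "\<lambda>k. M k * N k", OF MN x k]
      using M N k by (auto intro!: assoc_mult_mat_vec[symmetric])
  qed (use C D x in \<open>auto intro!: mult_mat_vec_carrier\<close>)
  then show "block_diag n M * block_diag n N *\<^sub>v x = block_diag n (\<lambda>k. M k * N k) *\<^sub>v x"
    using C x by simp
qed

lemma block_diag_add_smult:
  assumes M: "\<forall>k<n. M k \<in> carrier_mat b c"
    and N: "\<forall>k<n. N k \<in> carrier_mat b c"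
  shows "block_diag n M + w \<cdot>\<^sub>m block_diag n N = block_diag n (\<lambda>k. M k + w \<cdot>\<^sub>m N k)"
proof -
  have MN: "\<forall>k<n. M k + w \<cdot>\<^sub>m N k \<in> carrier_mat b c" using M N by auto
  have dim: "dim_row (N k) = b" "dim_col (N k) = c" if "k < n" for k using N that by auto
  show ?thesis
    unfolding block_diag_eq_mat[of n M, OF M] block_diag_eq_mat[of n N, OF N]
      block_diag_eq_mat[of n "\<lambda>k. M k + w \<cdot>\<^sub>m N k", OF MN]
    by (rule eq_matI) (auto simp: block_of_index dim)
qed

lemma dim_j2 [simp]: "dim_row j2 = 2" "dim_col j2 = 2"
  and j2_carrier [simp]: "j2 \<in> carrier_mat 2 2"
  by (auto simp: j2_def rot_def mat_of_rows_list_def)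

lemma j2_index [simp]:
  "j2 $$ (0, 0) = 0" "j2 $$ (0, Suc 0) = - 1" "j2 $$ (Suc 0, 0) = 1" "j2 $$ (Suc 0, Suc 0) = 0"
  by (auto simp: j2_def rot_def mat_of_rows_list_def)

text \<open>\<open>rho\<close> contains the products C J and L J, whereas \<open>YN_mat\<close> and
  \<open>ZT_mat\<close> contain J C and J L. The orders agree because every block of C and of the
  line inductances is a multiple of the identity.\<close>

lemma scalar_blocks_commute_kronecker:
  assumes B: "B \<in> carrier_mat b b"
  shows "block_diag n (\<lambda>k. c k \<cdot>\<^sub>m 1\<^sub>m b) * (1\<^sub>m n \<otimes>\<^sub>K B) = (1\<^sub>m n \<otimes>\<^sub>K B) * block_diag n (\<lambda>k. c k \<cdot>\<^sub>m 1\<^sub>m b)"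
  using B unfolding kronecker_one_eq_block_diag
  by (subst (1 2) block_diag_mult_block_diag[of _ _ b b _ b])
     (auto intro!: block_diag_cong simp: mult_smult_assoc_mat mult_smult_distrib)

section \<open>The network\<close>

lemma
  shows LT_carrier [simp]: "LT_mat S \<in> carrier_mat (n_line S * 2) (n_line S * 2)"
    and C_carrier [simp]: "C_mat S \<in> carrier_mat (n_bus S * 2) (n_bus S * 2)"
    and JT_carrier [simp]: "JT_mat S \<in> carrier_mat (n_line S * 2) (n_line S * 2)"
    and Jv_carrier [simp]: "Jv_mat S \<in> carrier_mat (n_bus S * 2) (n_bus S * 2)"
    and Yl_carrier [simp]: "Yl_mat S v \<in> carrier_mat (n_bus S * 2) (n_bus S * 2)"
    and incidence2_carrier [simp]: "incidence2 S \<in> carrier_mat (n_bus S * 2) (n_line S * 2)"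
  unfolding LT_mat_def C_mat_def JT_mat_def Jv_mat_def Yl_mat_def
    kronecker_one_eq_block_diag Let_def incidence2_def incidence_mat_def kronecker_def
  by (auto intro!: block_diag_carrier simp del: carrier_matI)

lemma C_Jv_commute: "C_mat S * Jv_mat S = Jv_mat S * C_mat S"
  unfolding C_mat_def Jv_mat_def by (rule scalar_blocks_commute_kronecker) simp

lemma LT_JT_commute: "LT_mat S * JT_mat S = JT_mat S * LT_mat S"
  unfolding LT_mat_def JT_mat_def by (rule scalar_blocks_commute_kronecker) simp

lemma ZT_carrier [simp]: "ZT_mat S w \<in> carrier_mat (n_line S * 2) (n_line S * 2)"
  unfolding ZT_mat_def
  by (intro add_carrier_mat smult_carrier_mat mult_carrier_mat[OF JT_carrier LT_carrier])

lemma ZT_eq_block_diag: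
  "ZT_mat S w = block_diag (n_line S) (\<lambda>t. r_T S t \<cdot>\<^sub>m 1\<^sub>m 2 + w \<cdot>\<^sub>m (l_T S t \<cdot>\<^sub>m j2))"
proof -
  have "JT_mat S * LT_mat S = block_diag (n_line S) (\<lambda>t. l_T S t \<cdot>\<^sub>m j2)"
    unfolding JT_mat_def LT_mat_def kronecker_one_eq_block_diag
    by (subst block_diag_mult_block_diag[of _ _ 2 2 _ 2])
       (auto intro!: block_diag_cong simp: mult_smult_distrib[of _ 2 2 _ 2])
  then show ?thesis
    unfolding ZT_mat_def RT_mat_def by (simp add: block_diag_add_smult[of _ _ 2 2])
qed

text \<open>Pairing the equation with x removes the skew part that comes from \<open>j2\<close> and
  leaves r times the squared norm of x.\<close>

lemma impedance_block_kernel: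
  assumes r: "r > 0" and x: "x \<in> carrier_vec 2"
    and eq: "(r \<cdot>\<^sub>m 1\<^sub>m 2 + w \<cdot>\<^sub>m (l \<cdot>\<^sub>m j2)) *\<^sub>v x = 0\<^sub>v 2"
  shows "x = 0\<^sub>v 2"
proof -
  let ?A = "r \<cdot>\<^sub>m 1\<^sub>m 2 + w \<cdot>\<^sub>m (l \<cdot>\<^sub>m j2)"
  have A: "?A \<in> carrier_mat 2 2" by auto
  have 0: "r * x $ 0 - w * l * x $ 1 = 0" and 1: "w * l * x $ 0 + r * x $ 1 = 0"
    using arg_cong[OF eq, of "\<lambda>v. v $ 0"] arg_cong[OF eq, of "\<lambda>v. v $ 1"]
    by (simp_all add: mult_mat_vec_index[OF A x] lessThan_nat_numeral algebra_simps
        del: index_mult_mat_vec)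
  have "r * ((x $ 0)\<^sup>2 + (x $ 1)\<^sup>2)
    = x $ 0 * (r * x $ 0 - w * l * x $ 1) + x $ 1 * (w * l * x $ 0 + r * x $ 1)"
    by (simp add: algebra_simps power2_eq_square)
  then have "(x $ 0)\<^sup>2 + (x $ 1)\<^sup>2 = 0" using 0 1 r by simp
  then have "x $ 0 = 0" "x $ 1 = 0" by (simp_all add: sum_power2_eq_zero_iff)
  then show ?thesis using x by (intro eq_vecI) (auto simp: less_2_cases_iff)
qed

text \<open>A zero determinant would give a nonzero kernel vector, but each of its blocks is
  annihilated by an impedance block with positive resistance and so vanishes. Hence
  \<open>mat_inverse\<close> does not return \<open>None\<close>, and \<open>the\<close> yields a
  two-sided inverse.\<close>

lemma ZT_inverse:
  fixes w :: real
  assumes "valid_power_system S"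
  defines "Zi \<equiv> the (mat_inverse (ZT_mat S w))"
  shows "Zi \<in> carrier_mat (n_line S * 2) (n_line S * 2)"
    and "ZT_mat S w * Zi = 1\<^sub>m (n_line S * 2)" and "Zi * ZT_mat S w = 1\<^sub>m (n_line S * 2)"
proof -
  let ?n = "n_line S * 2"
  have "det (ZT_mat S w) \<noteq> 0"
  proof
    assume "det (ZT_mat S w) = 0"
    then obtain x where x: "x \<in> carrier_vec ?n" "x \<noteq> 0\<^sub>v ?n" and Zx: "ZT_mat S w *\<^sub>v x = 0\<^sub>v ?n"
      using det_0_iff_vec_prod_zero_field[OF ZT_carrier] by blast
    have "x = 0\<^sub>v ?n"
    proof (rule vec_eq_blocksI)
      fix t assume t: "t < n_line S"
      have z: "nth_block 2 (0\<^sub>v ?n) t = 0\<^sub>v 2"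
        using block_index_less[OF t, of _ 2] by (intro eq_vecI) auto
      have "(r_T S t \<cdot>\<^sub>m 1\<^sub>m 2 + w \<cdot>\<^sub>m (l_T S t \<cdot>\<^sub>m j2)) *\<^sub>v nth_block 2 x t = 0\<^sub>v 2"
        using nth_block_block_diag_mult[OF _ x(1) t, of "\<lambda>t. r_T S t \<cdot>\<^sub>m 1\<^sub>m 2 + w \<cdot>\<^sub>m (l_T S t \<cdot>\<^sub>m j2)" 2] Zx z
        by (simp add: ZT_eq_block_diag)
      moreover have "r_T S t > 0" using assms(1) t by (simp add: valid_power_system_def)
      ultimately show "nth_block 2 x t = nth_block 2 (0\<^sub>v ?n) t"
        unfolding z using impedance_block_kernel[OF _ nth_block_carrier] by blast
    qed (use x in auto)
    with x(2) show False by simp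
  qed
  \<comment> \<open>A nonzero determinant makes the matrix a unit of \<open>ring_mat\<close>, which
    excludes \<open>None\<close>; the argument \<open>()\<close> instantiates the record extension
    of that ring.\<close>
  then have "mat_inverse (ZT_mat S w) \<noteq> None"
    using mat_inverse(1)[OF ZT_carrier, of S w "()"] det_non_zero_imp_unit[OF ZT_carrier, of S w "()"]
    by auto
  then have "mat_inverse (ZT_mat S w) = Some Zi" by (auto simp: Zi_def)
  from mat_inverse(2)[OF ZT_carrier this]
  show "Zi \<in> carrier_mat ?n ?n" "ZT_mat S w * Zi = 1\<^sub>m ?n" "Zi * ZT_mat S w = 1\<^sub>m ?n"
    by auto
qed

section \<open>Transposes, scalar multiples and the selection matrices\<close>

lemma transpose_block_diag:
  assumes M: "\<forall>k<n. M k \<in> carrier_mat b c"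
  shows "transpose_mat (block_diag n M) = block_diag n (\<lambda>k. transpose_mat (M k))"
proof -
  have T: "\<forall>k<n. transpose_mat (M k) \<in> carrier_mat c b" using M by auto
  have dim: "dim_row (M k) = b" "dim_col (M k) = c" if "k < n" for k using M that by auto
  show ?thesis
    unfolding block_diag_eq_mat[of n M, OF M] block_diag_eq_mat[of n "\<lambda>k. transpose_mat (M k)", OF T]
    by (rule eq_matI) (auto simp: block_of_index dim)
qed

lemma smult_mat_mult_vec:
  fixes A :: "'a :: comm_semiring_0 mat"
  assumes "A \<in> carrier_mat m n" "x \<in> carrier_vec n"
  shows "(c \<cdot>\<^sub>m A) *\<^sub>v x = c \<cdot>\<^sub>v (A *\<^sub>v x)"
  using assms by (intro eq_vecI) (auto simp: scalar_prod_def sum_distrib_left mult.assoc)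

text \<open>One diagonal block of \<open>Is_mat\<close>: the inclusion of the stator plane into the
  five currents of a machine.\<close>

abbreviation stator_pad :: "real mat" where
  "stator_pad \<equiv> 1\<^sub>m 2 @\<^sub>r 0\<^sub>m 3 2"

lemma stator_pad_carrier [simp]: "stator_pad \<in> carrier_mat 5 2"
  using carrier_append_rows[of "1\<^sub>m 2 :: real mat" 2 2 "0\<^sub>m 3 2" 3] by simp

lemma dim_stator_pad [simp]: "dim_row stator_pad = 5" "dim_col stator_pad = 2"
  using stator_pad_carrier by (auto simp del: stator_pad_carrier)

lemma stator_pad_index:
  "a < 5 \<Longrightarrow> b < 2 \<Longrightarrow> stator_pad $$ (a, b) = (if a = b then 1 else 0)"
  by (auto simp: append_rows_def)

lemma Is_carrier [simp]: "Is_mat S \<in> carrier_mat (n_gen S * 5) (n_gen S * 2)"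
  unfolding Is_mat_def kronecker_one_eq_block_diag by (intro block_diag_carrier) simp

text \<open>Through this term the machines enter the bus equations. Each transposed
  \<open>stator_pad\<close> keeps the first two currents of its machine, and the zero rows of
  \<open>Iv_mat\<close> say that no machine feeds a load bus.\<close>

lemma Iv_mult_vec:
  assumes i: "i \<in> carrier_vec (n_gen S * 5)"
  shows "Iv_mat S *\<^sub>v i = stator_currents S i @\<^sub>v 0\<^sub>v (2 * n_load S)"
proof -
  have "transpose_mat (Is_mat S) *\<^sub>v i = stator_currents S i"
  proof (rule vec_eq_blocksI)
    fix k assume k: "k < n_gen S"
    have "nth_block 2 (transpose_mat (Is_mat S) *\<^sub>v i) k = transpose_mat stator_pad *\<^sub>v nth_block 5 i k"
      unfolding Is_mat_def kronecker_one_eq_block_diag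
      by (subst transpose_block_diag[of _ _ 5 2]) (simp_all add: nth_block_block_diag_mult[of _ _ _ 5] i k)
    also have "\<dots> = nth_block 2 (stator_currents S i) k"
    proof (rule eq_vecI)
      fix a assume "a < dim_vec (nth_block 2 (stator_currents S i) k)"
      then have a: "a < 2" by simp
      have "(transpose_mat stator_pad *\<^sub>v nth_block 5 i k) $ a
          = (\<Sum>q<5. transpose_mat stator_pad $$ (a, q) * nth_block 5 i k $ q)"
        using a by (intro mult_mat_vec_index[of _ 2]) auto
      also have "\<dots> = (\<Sum>q<5. if q = a then i $ (k * 5 + q) else 0)"
        using a by (intro sum.cong) (auto simp: stator_pad_index)
      also have "\<dots> = i $ (k * 5 + a)" using a by simp
      also have "\<dots> = nth_block 2 (stator_currents S i) k $ a"
        using a block_index_less[OF k a]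
        by (simp add: stator_currents_def stack_vec_def vec_first_def)
      finally show "(transpose_mat stator_pad *\<^sub>v nth_block 5 i k) $ a
        = nth_block 2 (stator_currents S i) k $ a" .
    qed auto
    finally show "nth_block 2 (transpose_mat (Is_mat S) *\<^sub>v i) k = nth_block 2 (stator_currents S i) k" .
  next
    show "stator_currents S i \<in> carrier_vec (n_gen S * 2)"
      by (simp add: stator_currents_def stack_vec_def)
    show "transpose_mat (Is_mat S) *\<^sub>v i \<in> carrier_vec (n_gen S * 2)"
      using i by (intro mult_mat_vec_carrier[of _ _ "n_gen S * 5"]) auto
  qed
  moreover have "0\<^sub>m (2 * n_load S) (5 * n_gen S) *\<^sub>v i = 0\<^sub>v (2 * n_load S)"
    using i by (auto simp: mult.commute)
  moreover have "Iv_mat S *\<^sub>v i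
    = (transpose_mat (Is_mat S) *\<^sub>v i) @\<^sub>v (0\<^sub>m (2 * n_load S) (5 * n_gen S) *\<^sub>v i)"
    unfolding Iv_mat_def
    by (rule mat_mult_append[of _ "n_gen S * 2" "n_gen S * 5"]) (use i in \<open>auto simp: mult.commute\<close>)
  ultimately show ?thesis by simp
qed

lemma Iv_carrier:
  assumes "valid_power_system S"
  shows "Iv_mat S \<in> carrier_mat (n_bus S * 2) (n_gen S * 5)"
proof -
  have "Iv_mat S \<in> carrier_mat (n_gen S * 2 + 2 * n_load S) (n_gen S * 5)"
    unfolding Iv_mat_def by (intro carrier_append_rows) (auto simp: mult.commute)
  moreover have gen_le_bus: "n_gen S \<le> n_bus S"
    using assms by (simp add: valid_power_system_def)
  then have "n_gen S * 2 + 2 * n_load S = n_bus S * 2"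
    using gen_le_bus by (simp add: n_load_def)
  ultimately show ?thesis by simp
qed

text \<open>The columns that belong to load buses vanish. What remains is \<open>Is_mat\<close>
  acting on the generator voltages, and its blocks put the voltage of bus k into the stator rows of
  machine k.\<close>

lemma transpose_Iv_mult_vec_index:
  assumes S: "valid_power_system S" and v: "v \<in> carrier_vec (n_bus S * 2)"
    and k: "k < n_gen S" and a: "a < 5"
  shows "(transpose_mat (Iv_mat S) *\<^sub>v v) $ (k * 5 + a) = (if a < 2 then v $ (k * 2 + a) else 0)"
proof -
  have le: "n_gen S * 2 \<le> n_bus S * 2" using S by (simp add: valid_power_system_def)
  have p: "k * 5 + a < n_gen S * 5" using block_index_less[OF k a] .
  \<comment> \<open>The generator voltages form an initial segment of v because generator k sits at
    bus k.\<close>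
  let ?v = "vec (n_gen S * 2) (\<lambda>q. v $ q)"
  have dim: "dim_row (Is_mat S) = n_gen S * 5" "dim_col (Is_mat S) = n_gen S * 2"
    by (rule carrier_matD[OF Is_carrier])+
  have ent: "Iv_mat S $$ (q, k * 5 + a) = (if q < n_gen S * 2 then Is_mat S $$ (k * 5 + a, q) else 0)"
    if "q < n_bus S * 2" for q
    using that p Iv_carrier[OF S]
    by (auto simp: Iv_mat_def append_rows_def dim)
  have "(transpose_mat (Iv_mat S) *\<^sub>v v) $ (k * 5 + a)
      = (\<Sum>q<n_bus S * 2. transpose_mat (Iv_mat S) $$ (k * 5 + a, q) * v $ q)"
    using Iv_carrier[OF S] v p by (intro mult_mat_vec_index[of _ "n_gen S * 5"]) auto
  also have "\<dots> = (\<Sum>q<n_gen S * 2. Is_mat S $$ (k * 5 + a, q) * ?v $ q)"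
    using Iv_carrier[OF S] p le by (intro sum.mono_neutral_cong_right) (auto simp: ent)
  also have "\<dots> = (Is_mat S *\<^sub>v ?v) $ (k * 5 + a)"
    using p by (intro mult_mat_vec_index[symmetric]) auto
  also have "\<dots> = nth_block 5 (Is_mat S *\<^sub>v ?v) k $ a" using a by simp
  also have "\<dots> = (stator_pad *\<^sub>v nth_block 2 ?v k) $ a"
    unfolding Is_mat_def kronecker_one_eq_block_diag
    by (subst nth_block_block_diag_mult[of _ _ 5 2]) (use k in auto)
  also have "\<dots> = (\<Sum>q<2. stator_pad $$ (a, q) * nth_block 2 ?v k $ q)"
    using a by (intro mult_mat_vec_index[of _ 5]) auto
  also have "\<dots> = (\<Sum>q<2. if q = a then v $ (k * 2 + q) else 0)"
    using a block_index_less[OF k] by (intro sum.cong) (auto simp: stator_pad_index)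
  also have "\<dots> = (if a < 2 then v $ (k * 2 + a) else 0)"
    by simp
  finally show ?thesis .
qed

lemma If_carrier [simp]: "If_mat S \<in> carrier_mat (n_gen S * 5) (n_gen S)"
  by (auto simp: If_mat_def kronecker_def mat_of_rows_list_def)

text \<open>Excitation voltages are treated as blocks of size 1. Counting from 0, index 2 is the
  field winding, after the two stator components.\<close>

lemma If_mult_vec_index:
  assumes vf: "vf \<in> carrier_vec (n_gen S)" and k: "k < n_gen S" and a: "a < 5"
  shows "(If_mat S *\<^sub>v vf) $ (k * 5 + a) = (if a = 2 then vf $ k else 0)"
proof -
  let ?F = "mat_of_rows_list 1 [[0], [0], [1], [0], [0 :: real]]"
  have F: "?F \<in> carrier_mat 5 1" by (intro carrier_matI) (auto simp: mat_of_rows_list_def)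
  have "(If_mat S *\<^sub>v vf) $ (k * 5 + a) = nth_block 5 (If_mat S *\<^sub>v vf) k $ a"
    using a by simp
  also have "\<dots> = (?F *\<^sub>v nth_block 1 vf k) $ a"
    unfolding If_mat_def kronecker_one_eq_block_diag
    by (subst nth_block_block_diag_mult[of _ _ 5 1]) (use F vf k in auto)
  also have "\<dots> = (\<Sum>q<1. ?F $$ (a, q) * nth_block 1 vf k $ q)"
    using F a by (intro mult_mat_vec_index[of _ 5]) auto
  also have "\<dots> = (if a = 2 then vf $ k else 0)"
    using a by (auto simp: mat_of_rows_list_def nth_Cons')
  finally show ?thesis .
qed

section \<open>The machines\<close>

lemma J5_eq_mat:
  "J5 = mat 5 5 (\<lambda>(a, b). if a = 0 \<and> b = 1 then - 1 else if a = 1 \<and> b = 0 then 1 else 0)"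
  by (rule eq_matI) (auto simp: J5_def Let_def less_Suc_eq numeral_eq_Suc)

lemma J5_carrier [simp]: "J5 \<in> carrier_mat 5 5"
  by (simp add: J5_eq_mat)

lemma transpose_J5: "transpose_mat J5 = - J5"
  by (rule eq_matI) (auto simp: J5_eq_mat)

text \<open>A quarter turn in the stator plane and zero on the rotor, so the rotor rows of the
  machine equations will contain no flux term.\<close>

lemma J5_mult_vec_index:
  assumes "y \<in> carrier_vec 5" "a < 5"
  shows "(J5 *\<^sub>v y) $ a = (if a = 0 then - y $ 1 else if a = 1 then y $ 0 else 0)"
  unfolding mult_mat_vec_index[OF J5_carrier assms] using assms(2)
  by (auto simp: lessThan_nat_numeral J5_eq_mat)

lemma Lk_carrier [simp]: "Lk_mat S k t \<in> carrier_mat 5 5"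
proof -
  have "Lk_mat S k t \<in> carrier_mat (2 + 3) (2 + 3)"
    unfolding Lk_mat_def
    by (rule four_block_carrier_mat)
       (auto simp: Ls_mat_def Lr_mat_def rot_def mat_of_rows_list_def)
  then show ?thesis by simp
qed

lemmas machine_dims [simp] = carrier_matD(1)[OF J5_carrier] carrier_matD(1)[OF Lk_carrier]

text \<open>\<open>J5\<close> sees only the stator components of the flux. With both damper currents
  at zero, the field current is the sole rotor contribution to them.\<close>

lemma Lk_mult_vec_index:
  fixes t :: real
  assumes x: "x \<in> carrier_vec 5" and "x $ 3 = 0" "x $ 4 = 0"
  shows "(Lk_mat S k t *\<^sub>v x) $ 0
      = (l_s S k + l_sa S k * cos (2 * t)) * x $ 0 + l_sa S k * sin (2 * t) * x $ 1
        + l_sf S k * cos t * x $ 2"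
    and "(Lk_mat S k t *\<^sub>v x) $ 1
      = l_sa S k * sin (2 * t) * x $ 0 + (l_s S k - l_sa S k * cos (2 * t)) * x $ 1
        + l_sf S k * sin t * x $ 2"
  using assms
  by (simp_all add: mult_mat_vec_index[OF Lk_carrier x] lessThan_nat_numeral
      Lk_mat_def Ls_mat_def Lm_mat_def Lr_mat_def rot_def mat_of_rows_list_def
      times_mat_def scalar_prod_def atLeast0LessThan algebra_simps)


text \<open>Let z = a + i b and P = p + i q. The equations become lsa e^{2it} conj(z) + lsf e^{it} f
  = P. After division by e^{it} the first term is the conjugate of lsa e^{-it} z, so f is real
  exactly when e^{-it} (lsa z + P) is real. For w = 0 no choice of t and f could influence the two
  equations.\<close>

lemma machine_alignment:
  fixes w r ls lsa lsf a b v0 v1 :: real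
  assumes "w \<noteq> 0" "lsf \<noteq> 0"
  obtains t f where
    "r * a - w * (lsa * sin (2 * t) * a + (ls - lsa * cos (2 * t)) * b + lsf * sin t * f) = v0"
    "r * b + w * ((ls + lsa * cos (2 * t)) * a + lsa * sin (2 * t) * b + lsf * cos t * f) = v1"
proof -
  \<comment> \<open>The part of the flux that depends on t and f must equal P: p comes from the
    second equation and q from the first.\<close>
  define p q where "p = (v1 - r * b) / w - ls * a" and "q = (r * a - v0) / w - ls * b"
  \<comment> \<open>Polar form of lsa z + P. If this number is 0, then m = 0 and any angle will
    do.\<close>
  obtain m t where m: "lsa * a + p = m * cos t" "lsa * b + q = m * sin t"
    using polar_Ex by metis
  \<comment> \<open>The real part of e^{-it} P is m minus lsa times a cos t + b sin t, and the
    conjugated term subtracts the same amount once more; hence the factor 2.\<close>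
  define f where "f = (m - 2 * lsa * (a * cos t + b * sin t)) / lsf"
  have f: "lsf * f = m - 2 * lsa * (a * cos t + b * sin t)"
    using assms by (simp add: f_def)
  have dbl: "sin (2 * t) = 2 * sin t * cos t" "cos (2 * t) = 2 * (cos t)\<^sup>2 - 1"
    by (simp_all add: sin_double cos_double_cos)
  have "lsa * cos (2 * t) * a + lsa * sin (2 * t) * b + cos t * (lsf * f) = m * cos t - lsa * a"
    unfolding f dbl by (simp add: algebra_simps power2_eq_square)
  then have 1: "lsa * cos (2 * t) * a + lsa * sin (2 * t) * b + cos t * (lsf * f) = p"
    using m by simp
  have "lsa * sin (2 * t) * a - lsa * cos (2 * t) * b + sin t * (lsf * f)
      = m * sin t - lsa * b"
  proof -
    have "b * lsa * 2 * (sin t * sin t) = b * lsa * 2 - b * lsa * 2 * (cos t * cos t)"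
      using sin_squared_eq[of t] by (simp add: power2_eq_square right_diff_distrib)
    then show ?thesis
      unfolding f dbl by (simp add: algebra_simps power2_eq_square)
  qed
  then have 2: "lsa * sin (2 * t) * a - lsa * cos (2 * t) * b + sin t * (lsf * f) = q"
    using m by simp
  show ?thesis
  proof (rule that[of t f])
    have "lsa * sin (2 * t) * a + (ls - lsa * cos (2 * t)) * b + lsf * sin t * f = q + ls * b"
      unfolding 2[symmetric] by (simp add: algebra_simps)
    then show "r * a - w * (lsa * sin (2 * t) * a + (ls - lsa * cos (2 * t)) * b + lsf * sin t * f) = v0"
      using assms by (simp add: q_def)
    have "(ls + lsa * cos (2 * t)) * a + lsa * sin (2 * t) * b + lsf * cos t * f = p + ls * a"
      unfolding 1[symmetric] by (simp add: algebra_simps)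
    then show "r * b + w * ((ls + lsa * cos (2 * t)) * a + lsa * sin (2 * t) * b + lsf * cos t * f) = v1"
      using assms by (simp add: p_def)
  qed
qed

section \<open>The stacked machine equations\<close>

lemma
  shows R_carrier [simp]: "R_mat S \<in> carrier_mat (n_gen S * 5) (n_gen S * 5)"
    and L_carrier [simp]: "L_mat S \<theta> \<in> carrier_mat (n_gen S * 5) (n_gen S * 5)"
    and Jg_carrier [simp]: "Jg_mat S \<in> carrier_mat (n_gen S * 5) (n_gen S * 5)"
  unfolding R_mat_def L_mat_def Jg_mat_def kronecker_one_eq_block_diag
  by (auto intro!: block_diag_carrier simp del: carrier_matI)

lemma R_mult_vec_index:
  assumes i: "i \<in> carrier_vec (n_gen S * 5)" and k: "k < n_gen S" and a: "a < 5"
  shows "(R_mat S *\<^sub>v i) $ (k * 5 + a)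
    = [r_s S k, r_s S k, r_f S k, r_d S k, r_q S k] ! a * i $ (k * 5 + a)"
proof -
  let ?r = "\<lambda>k a. [r_s S k, r_s S k, r_f S k, r_d S k, r_q S k] ! a"
  have "(R_mat S *\<^sub>v i) $ (k * 5 + a) = nth_block 5 (R_mat S *\<^sub>v i) k $ a"
    using a by simp
  also have "\<dots> = (mat_diag 5 (?r k) *\<^sub>v nth_block 5 i k) $ a"
    unfolding R_mat_def by (subst nth_block_block_diag_mult[of _ _ 5 5]) (use i k in auto)
  also have "\<dots> = (\<Sum>q<5. mat_diag 5 (?r k) $$ (a, q) * nth_block 5 i k $ q)"
    using a by (intro mult_mat_vec_index[of _ 5]) auto
  also have "\<dots> = (\<Sum>q<5. if q = a then ?r k q * i $ (k * 5 + q) else 0)"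
    using a by (intro sum.cong) (auto simp: mat_diag_def)
  also have "\<dots> = ?r k a * i $ (k * 5 + a)"
    using a by simp
  finally show ?thesis .
qed

text \<open>At synchronous speed the two terms containing \<open>L J\<close> cancel because \<open>J\<^sup>T = - J\<close>.\<close>

lemma flux_terms_index:
  assumes i: "i \<in> carrier_vec (n_gen S * 5)" and k: "k < n_gen S" and a: "a < 5" and \<omega>: "\<omega> $ k = w"
  shows "((w \<cdot>\<^sub>m (L_mat S \<theta> * Jg_mat S)) *\<^sub>v i) $ (k * 5 + a) + v_ind S \<theta> \<omega> i $ (k * 5 + a)
    = w * (J5 *\<^sub>v (Lk_mat S k (\<theta> $ k) *\<^sub>v nth_block 5 i k)) $ a"
proof -
  let ?L = "Lk_mat S k (\<theta> $ k)" and ?x = "nth_block 5 i k"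
  have p: "k * 5 + a < n_gen S * 5" using block_index_less[OF k a] .
  have LJ: "L_mat S \<theta> * Jg_mat S = block_diag (n_gen S) (\<lambda>k. Lk_mat S k (\<theta> $ k) * J5)"
    unfolding L_mat_def Jg_mat_def kronecker_one_eq_block_diag
    by (rule block_diag_mult_block_diag[of _ _ 5 5 _ 5]) auto
  have LJi: "(L_mat S \<theta> * Jg_mat S) *\<^sub>v i \<in> carrier_vec (n_gen S * 5)"
    using i by (intro mult_mat_vec_carrier[OF mult_carrier_mat[OF L_carrier Jg_carrier]])
  have "((w \<cdot>\<^sub>m (L_mat S \<theta> * Jg_mat S)) *\<^sub>v i) $ (k * 5 + a)
      = (w \<cdot>\<^sub>v ((L_mat S \<theta> * Jg_mat S) *\<^sub>v i)) $ (k * 5 + a)"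
    by (simp only: smult_mat_mult_vec[OF mult_carrier_mat[OF L_carrier Jg_carrier] i])
  also have "\<dots> = w * nth_block 5 ((L_mat S \<theta> * Jg_mat S) *\<^sub>v i) k $ a"
    using p a carrier_vecD[OF LJi] by (simp del: dim_mult_mat_vec index_mult_mat_vec)
  also have "nth_block 5 ((L_mat S \<theta> * Jg_mat S) *\<^sub>v i) k = (?L * J5) *\<^sub>v ?x"
    unfolding LJ by (subst nth_block_block_diag_mult[of _ _ 5 5])
      (use i k in \<open>auto intro!: mult_carrier_mat[of _ _ 5]\<close>)
  finally have 1: "((w \<cdot>\<^sub>m (L_mat S \<theta> * Jg_mat S)) *\<^sub>v i) $ (k * 5 + a) = w * ((?L * J5) *\<^sub>v ?x) $ a" .
  have LJ5: "?L * J5 \<in> carrier_mat 5 5" and JL5: "J5 * ?L \<in> carrier_mat 5 5"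
    by (auto intro!: mult_carrier_mat[of _ _ 5])
  have "?L * transpose_mat J5 = - (?L * J5)"
    unfolding transpose_J5 by (rule uminus_mult_right_mat) (simp add: J5_eq_mat carrier_matD[OF Lk_carrier])
  then have "(?L * transpose_mat J5 + J5 * ?L) *\<^sub>v ?x = (- (?L * J5)) *\<^sub>v ?x + (J5 * ?L) *\<^sub>v ?x"
    using LJ5 JL5 by (simp add: add_mult_distrib_mat_vec[of _ 5 5])
  also have "(- (?L * J5)) *\<^sub>v ?x = - ((?L * J5) *\<^sub>v ?x)"
    using LJ5 by (intro uminus_mult_mat_vec) auto
  finally have V: "(?L * transpose_mat J5 + J5 * ?L) *\<^sub>v ?x = - ((?L * J5) *\<^sub>v ?x) + (J5 * ?L) *\<^sub>v ?x" .
  have d: "(?L * J5) *\<^sub>v ?x \<in> carrier_vec 5" "(J5 * ?L) *\<^sub>v ?x \<in> carrier_vec 5"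
    using LJ5 JL5 by (auto intro!: mult_mat_vec_carrier)
  have "v_ind S \<theta> \<omega> i $ (k * 5 + a) = w * ((?L * transpose_mat J5 + J5 * ?L) *\<^sub>v ?x) $ a"
    using p a LJ5 JL5 by (simp add: v_ind_def stack_vec_def Let_def \<omega> V del: index_mult_mat_vec)
  also have "\<dots> = w * (- ((?L * J5) *\<^sub>v ?x) $ a + ((J5 * ?L) *\<^sub>v ?x) $ a)"
    unfolding V using a carrier_vecD[OF d(1)] carrier_vecD[OF d(2)]
    by (simp del: index_mult_mat_vec dim_mult_mat_vec)
  also have "(J5 * ?L) *\<^sub>v ?x = J5 *\<^sub>v (?L *\<^sub>v ?x)"
    by (rule assoc_mult_mat_vec[of _ 5 5 _ 5]) auto
  finally show ?thesis unfolding 1 by (simp add: algebra_simps)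
qed

text \<open>The voltage equations of the machine windings, which form the third block of
  \<open>rho\<close>.\<close>

definition machine_residual ::
    "power_system \<Rightarrow> real vec \<Rightarrow> real vec \<Rightarrow> real vec \<Rightarrow> real vec \<Rightarrow> real vec \<Rightarrow> real \<Rightarrow> real vec" where
  "machine_residual S \<theta> \<omega> i v vf w =
     (R_mat S + w \<cdot>\<^sub>m (L_mat S \<theta> * Jg_mat S)) *\<^sub>v i
       - transpose_mat (Iv_mat S) *\<^sub>v v - If_mat S *\<^sub>v vf + v_ind S \<theta> \<omega> i"

lemma v_ind_carrier [simp]: "v_ind S \<theta> \<omega> i \<in> carrier_vec (n_gen S * 5)"
  by (simp add: v_ind_def stack_vec_def)

lemma dim_v_ind [simp]: "dim_vec (v_ind S \<theta> \<omega> i) = n_gen S * 5"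
  by (simp add: v_ind_def stack_vec_def)

lemma machine_residual_carrier [simp]:
  "machine_residual S \<theta> \<omega> i v vf w \<in> carrier_vec (n_gen S * 5)"
  unfolding machine_residual_def by (rule add_carrier_vec[OF _ v_ind_carrier])
    (metis If_carrier carrier_matD(1) carrier_vecI dim_mult_mat_vec index_minus_vec(2))

text \<open>The condition on \<open>\<omega>\<close> puts machine k at synchronous speed, so
  \<open>flux_terms_index\<close> merges the two flux terms. Each row then consists of a resistive
  drop and a rotated flux, less the applied voltage.\<close>

lemma machine_residual_index:
  assumes S: "valid_power_system S" and i: "i \<in> carrier_vec (n_gen S * 5)"
    and v: "v \<in> carrier_vec (n_bus S * 2)" and vf: "vf \<in> carrier_vec (n_gen S)"
    and k: "k < n_gen S" and a: "a < 5" and \<omega>: "\<omega> $ k = w"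
  shows "machine_residual S \<theta> \<omega> i v vf w $ (k * 5 + a)
    = [r_s S k, r_s S k, r_f S k, r_d S k, r_q S k] ! a * i $ (k * 5 + a)
      + w * (J5 *\<^sub>v (Lk_mat S k (\<theta> $ k) *\<^sub>v nth_block 5 i k)) $ a
      - (if a < 2 then v $ (k * 2 + a) else 0) - (if a = 2 then vf $ k else 0)"
proof -
  let ?LJ = "w \<cdot>\<^sub>m (L_mat S \<theta> * Jg_mat S)"
  have p: "k * 5 + a < n_gen S * 5" using block_index_less[OF k a] .
  have LJ: "?LJ \<in> carrier_mat (n_gen S * 5) (n_gen S * 5)"
    using mult_carrier_mat[OF L_carrier Jg_carrier] by simp
  have vecs: "?LJ *\<^sub>v i \<in> carrier_vec (n_gen S * 5)" "R_mat S *\<^sub>v i \<in> carrier_vec (n_gen S * 5)"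
    "If_mat S *\<^sub>v vf \<in> carrier_vec (n_gen S * 5)"
    "transpose_mat (Iv_mat S) *\<^sub>v v \<in> carrier_vec (n_gen S * 5)"
    using i v vf LJ Iv_carrier[OF S]
    by (auto intro!: mult_mat_vec_carrier)
  have "machine_residual S \<theta> \<omega> i v vf w $ (k * 5 + a)
    = (R_mat S *\<^sub>v i) $ (k * 5 + a) + (?LJ *\<^sub>v i) $ (k * 5 + a)
      - (transpose_mat (Iv_mat S) *\<^sub>v v) $ (k * 5 + a) - (If_mat S *\<^sub>v vf) $ (k * 5 + a)
      + v_ind S \<theta> \<omega> i $ (k * 5 + a)"
    unfolding machine_residual_def add_mult_distrib_mat_vec[OF R_carrier LJ i]
    using p vecs[THEN carrier_vecD]
    by (simp del: index_mult_mat_vec dim_mult_mat_vec)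
  then show ?thesis
    using flux_terms_index[OF i k a \<omega>, of \<theta>]
    by (simp only: R_mult_vec_index[OF i k a] transpose_Iv_mult_vec_index[OF S v k a]
        If_mult_vec_index[OF vf k a])
qed

text \<open>The damper currents have to vanish, and the excitation voltage only compensates the losses
  of the field winding; rotor angle and field current remain to match the two stator equations.\<close>

lemma machines_solvable:
  assumes S: "valid_power_system S" and w: "w \<noteq> 0"
    and cur: "is \<in> carrier_vec (n_gen S * 2)" and v: "v \<in> carrier_vec (n_bus S * 2)"
  obtains \<theta> i vf where "\<theta> \<in> carrier_vec (n_gen S)" "i \<in> carrier_vec (n_gen S * 5)"
    "vf \<in> carrier_vec (n_gen S)" "stator_currents S i = is"
    "machine_residual S \<theta> (w \<cdot>\<^sub>v vec (n_gen S) (\<lambda>_. 1)) i v vf w = 0\<^sub>v (n_gen S * 5)"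
proof -
  \<comment> \<open>The two stator equations of machine k with the prescribed current and voltage
    inserted, arranged to match \<open>machine_alignment\<close>.\<close>
  let ?sol = "\<lambda>k t f.
    r_s S k * is $ (k * 2) - w * (l_sa S k * sin (2 * t) * is $ (k * 2)
      + (l_s S k - l_sa S k * cos (2 * t)) * is $ (k * 2 + 1) + l_sf S k * sin t * f) = v $ (k * 2)
    \<and> r_s S k * is $ (k * 2 + 1) + w * ((l_s S k + l_sa S k * cos (2 * t)) * is $ (k * 2)
      + l_sa S k * sin (2 * t) * is $ (k * 2 + 1) + l_sf S k * cos t * f) = v $ (k * 2 + 1)"
  have "\<exists>t f. ?sol k t f" if "k < n_gen S" for k
  proof -
    have "l_sf S k \<noteq> 0" using S that by (fastforce simp: valid_power_system_def)
    then show ?thesis using machine_alignment[OF w] by metis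
  qed
  then obtain t f where sol: "\<And>k. k < n_gen S \<Longrightarrow> ?sol k (t k) (f k)"
    by metis
  define \<theta> where "\<theta> = vec (n_gen S) t"
  define vf where "vf = vec (n_gen S) (\<lambda>k. r_f S k * f k)"
  define i where "i = stack_vec 5 (n_gen S)
    (\<lambda>k. vec 5 (\<lambda>a. [is $ (k * 2), is $ (k * 2 + 1), f k, 0, 0] ! a))"
  have i: "i \<in> carrier_vec (n_gen S * 5)" by (simp add: i_def stack_vec_def)
  have i_index: "i $ (k * 5 + a) = [is $ (k * 2), is $ (k * 2 + 1), f k, 0, 0] ! a"
    if "k < n_gen S" "a < 5" for k a
    using block_index_less[OF that] that(2) by (simp add: i_def stack_vec_def)
  have "stator_currents S i = is"
  proof (rule vec_eq_blocksI)
    fix k assume k: "k < n_gen S"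
    show "nth_block 2 (stator_currents S i) k = nth_block 2 is k"
    proof (rule eq_vecI)
      fix a assume "a < dim_vec (nth_block 2 is k)"
      then have a: "a < 2" by simp
      then show "nth_block 2 (stator_currents S i) k $ a = nth_block 2 is k $ a"
        using block_index_less[OF k a] k i_index[OF k, of 0] i_index[OF k, of 1]
        by (auto simp: stator_currents_def stack_vec_def vec_first_def i_index less_2_cases_iff)
    qed simp
  qed (use cur in \<open>auto simp: stator_currents_def stack_vec_def\<close>)
  moreover have "machine_residual S \<theta> (w \<cdot>\<^sub>v vec (n_gen S) (\<lambda>_. 1)) i v vf w = 0\<^sub>v (n_gen S * 5)"
  proof (rule vec_eq_blocksI)
    fix k assume k: "k < n_gen S"
    let ?x = "nth_block 5 i k"
    have x: "?x $ 0 = is $ (k * 2)" "?x $ 1 = is $ (k * 2 + 1)" "?x $ 2 = f k" "?x $ 3 = 0" "?x $ 4 = 0"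
      using k i_index[OF k, of 0] i_index[OF k, of 1] i_index[OF k, of 2] by (simp_all add: i_index)
    let ?y = "Lk_mat S k (\<theta> $ k) *\<^sub>v ?x"
    have y: "?y \<in> carrier_vec 5" by (intro mult_mat_vec_carrier[of _ 5 5]) auto
    note Lk = Lk_mult_vec_index[of ?x S k "t k", OF nth_block_carrier x(4,5), unfolded x]
    show "nth_block 5 (machine_residual S \<theta> (w \<cdot>\<^sub>v vec (n_gen S) (\<lambda>_. 1)) i v vf w) k
      = nth_block 5 (0\<^sub>v (n_gen S * 5)) k"
    proof (rule eq_vecI)
      fix a assume "a < dim_vec (nth_block 5 (0\<^sub>v (n_gen S * 5)) k)"
      then have a: "a < 5" by simp
      have "machine_residual S \<theta> (w \<cdot>\<^sub>v vec (n_gen S) (\<lambda>_. 1)) i v vf w $ (k * 5 + a)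
        = [r_s S k, r_s S k, r_f S k, r_d S k, r_q S k] ! a * i $ (k * 5 + a)
          + w * (J5 *\<^sub>v ?y) $ a
          - (if a < 2 then v $ (k * 2 + a) else 0) - (if a = 2 then vf $ k else 0)"
        using k by (intro machine_residual_index[OF S i v _ k a]) (auto simp: vf_def)
      also have "\<dots> = 0"
      proof -
        \<comment> \<open>Rows 0 and 1 are the two equations in \<open>?sol\<close>. Row 2 is
          balanced by \<open>vf\<close>. Rows 3 and 4 hold because the damper currents are zero and
          \<open>J5\<close> has zero rows there.\<close>
        have cases: "a = 0 \<or> a = 1 \<or> a = 2 \<or> a = 3 \<or> a = 4" using a by auto
        show ?thesis
          unfolding J5_mult_vec_index[OF y a] i_index[OF k a]
          using cases sol[OF k] k
          by (auto simp: \<theta>_def vf_def Lk[unfolded One_nat_def] algebra_simps simp del: index_mult_mat_vec)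
      qed
      finally show "nth_block 5 (machine_residual S \<theta> (w \<cdot>\<^sub>v vec (n_gen S) (\<lambda>_. 1)) i v vf w) k $ a
        = nth_block 5 (0\<^sub>v (n_gen S * 5)) k $ a"
        using a block_index_less[OF k a] by simp
    qed simp
  qed auto
  ultimately show ?thesis
    using i by (intro that[of \<theta> i vf]) (auto simp: \<theta>_def vf_def)
qed


section \<open>Steady states\<close>

lemmas network_dims [simp] =
  carrier_matD(1)[OF Yl_carrier] carrier_matD(1)[OF incidence2_carrier]

lemma dim_i_load [simp]: "dim_vec (i_load S v) = n_bus S * 2"
  by (simp add: i_load_def)

lemma stator_currents_carrier [simp]: "stator_currents S i \<in> carrier_vec (2 * n_gen S)"
  by (simp add: stator_currents_def stack_vec_def)

lemma D_carrier [simp]: "D_mat S \<in> carrier_mat (n_gen S) (n_gen S)"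
  by (simp add: D_mat_def)

lemma torque_carrier [simp]: "torque S \<theta> i \<in> carrier_vec (n_gen S)"
  by (simp add: torque_def)

text \<open>Kirchhoff's current law at the buses, the fourth block of \<open>rho\<close>.\<close>

definition network_residual :: "power_system \<Rightarrow> real vec \<Rightarrow> real vec \<Rightarrow> real vec \<Rightarrow> real \<Rightarrow> real vec" where
  "network_residual S i v iT w =
     w \<cdot>\<^sub>v ((C_mat S * Jv_mat S) *\<^sub>v v) + Iv_mat S *\<^sub>v i + incidence2 S *\<^sub>v iT + i_load S v"

text \<open>Comparing concatenated vectors piece by piece requires the lengths of the leading
  blocks, which the carrier facts provide. Commuting \<open>LT_mat\<close> with
  \<open>JT_mat\<close> makes \<open>ZT_mat\<close> appear in the last block.\<close>

lemma rho_eq_0_iff: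
  assumes S: "valid_power_system S"
    and \<omega>: "\<omega> \<in> carrier_vec (n_gen S)" and \<tau>m: "\<tau>m \<in> carrier_vec (n_gen S)"
  shows "rho S (\<theta>, \<omega>, i, v, iT) (\<tau>m, vf) w = 0\<^sub>v (rho_dim S) \<longleftrightarrow>
    w \<cdot>\<^sub>v vec (n_gen S) (\<lambda>_. 1) - \<omega> = 0\<^sub>v (n_gen S) \<and>
    D_mat S *\<^sub>v \<omega> + torque S \<theta> i - \<tau>m = 0\<^sub>v (n_gen S) \<and>
    machine_residual S \<theta> \<omega> i v vf w = 0\<^sub>v (n_gen S * 5) \<and>
    network_residual S i v iT w = 0\<^sub>v (n_bus S * 2) \<and>
    ZT_mat S w *\<^sub>v iT - transpose_mat (incidence2 S) *\<^sub>v v = 0\<^sub>v (n_line S * 2)"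
proof -
  have zero: "0\<^sub>v (rho_dim S) = 0\<^sub>v (n_gen S) @\<^sub>v 0\<^sub>v (n_gen S) @\<^sub>v 0\<^sub>v (n_gen S * 5)
      @\<^sub>v 0\<^sub>v (n_bus S * 2) @\<^sub>v 0\<^sub>v (n_line S * 2)"
    by (rule eq_vecI) (auto simp: rho_dim_def)
  have 1: "w \<cdot>\<^sub>v vec (n_gen S) (\<lambda>_. 1) - \<omega> \<in> carrier_vec (n_gen S)"
    using \<omega> by auto
  have 2: "D_mat S *\<^sub>v \<omega> + torque S \<theta> i - \<tau>m \<in> carrier_vec (n_gen S)"
    by (intro minus_carrier_vec add_carrier_vec mult_mat_vec_carrier[OF D_carrier] \<omega> \<tau>m torque_carrier)
  have 4: "network_residual S i v iT w \<in> carrier_vec (n_bus S * 2)"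
    unfolding network_residual_def
    by (rule carrier_vecI) simp
  show ?thesis
    unfolding zero rho_def ZT_mat_def LT_JT_commute[symmetric] prod.case
    unfolding machine_residual_def[symmetric] network_residual_def[symmetric]
    unfolding append_vec_eq[OF 1 zero_carrier_vec] append_vec_eq[OF 2 zero_carrier_vec]
      append_vec_eq[OF machine_residual_carrier zero_carrier_vec]
      append_vec_eq[OF 4 zero_carrier_vec] ..
qed

lemma diff_eq_zero_vec_iff:
  fixes x y :: "'a :: group_add vec"
  assumes "x \<in> carrier_vec n" "y \<in> carrier_vec n"
  shows "x - y = 0\<^sub>v n \<longleftrightarrow> x = y"
  using assms by (auto simp: vec_eq_iff)

text \<open>Applied with y the voltages across the lines. One direction forces the line currents of
  a given steady state, the other supplies them when a steady state is built.\<close>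

lemma line_currents_unique:
  assumes S: "valid_power_system S"
    and iT: "iT \<in> carrier_vec (n_line S * 2)" and y: "y \<in> carrier_vec (n_line S * 2)"
  shows "ZT_mat S w *\<^sub>v iT - y = 0\<^sub>v (n_line S * 2) \<longleftrightarrow>
    iT = the (mat_inverse (ZT_mat S w)) *\<^sub>v y"
proof -
  let ?Z = "ZT_mat S w" and ?Zi = "the (mat_inverse (ZT_mat S w))"
  note Zi = ZT_inverse[OF S, of w]
  have "?Z *\<^sub>v iT - y = 0\<^sub>v (n_line S * 2) \<longleftrightarrow> ?Z *\<^sub>v iT = y"
    by (rule diff_eq_zero_vec_iff[OF mult_mat_vec_carrier[OF ZT_carrier iT] y])
  also have "\<dots> \<longleftrightarrow> iT = ?Zi *\<^sub>v y"
    using assoc_mult_mat_vec[OF Zi(1) ZT_carrier iT] assoc_mult_mat_vec[OF ZT_carrier Zi(1) y]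
      Zi(2,3) iT y by (metis one_mult_mat_vec)
  finally show ?thesis .
qed

text \<open>Splits the current drawn from the buses into loads, shunt capacitors and lines, in the
  form in which these terms occur in the bus equations.\<close>

lemma YN_mult_vec:
  assumes S: "valid_power_system S" and v: "v \<in> carrier_vec (n_bus S * 2)"
  shows "YN_mat S w v *\<^sub>v v = i_load S v + w \<cdot>\<^sub>v ((C_mat S * Jv_mat S) *\<^sub>v v)
    + incidence2 S *\<^sub>v (the (mat_inverse (ZT_mat S w)) *\<^sub>v (transpose_mat (incidence2 S) *\<^sub>v v))"
proof -
  let ?Zi = "the (mat_inverse (ZT_mat S w))" and ?E = "incidence2 S" and ?n = "n_bus S * 2"
  have Zi: "?Zi \<in> carrier_mat (n_line S * 2) (n_line S * 2)" using ZT_inverse(1)[OF S] .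
  have T: "transpose_mat ?E \<in> carrier_mat (n_line S * 2) ?n" by simp
  have EZ: "?E * ?Zi \<in> carrier_mat ?n (n_line S * 2)"
    by (rule mult_carrier_mat[OF incidence2_carrier Zi])
  have CJ: "C_mat S * Jv_mat S \<in> carrier_mat ?n ?n"
    by (rule mult_carrier_mat[OF C_carrier Jv_carrier])
  have YC: "Yl_mat S v + w \<cdot>\<^sub>m (C_mat S * Jv_mat S) \<in> carrier_mat ?n ?n"
    using CJ by simp
  show ?thesis
    unfolding YN_mat_def i_load_def C_Jv_commute[symmetric]
      add_mult_distrib_mat_vec[OF YC mult_carrier_mat[OF EZ T] v]
      add_mult_distrib_mat_vec[OF Yl_carrier smult_carrier_mat[OF CJ] v]
      smult_mat_mult_vec[OF CJ v] assoc_mult_mat_vec[OF EZ T v]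
      assoc_mult_mat_vec[OF incidence2_carrier Zi mult_mat_vec_carrier[OF T v]] ..
qed

text \<open>With the line currents eliminated, the bus equations say that loads, capacitors and
  lines together draw the negative of \<open>Iv_mat S *\<^sub>v i\<close>, and by
  \<open>Iv_mult_vec\<close> this is the padded stator current.\<close>

lemma network_balance_iff:
  fixes w :: real
  assumes S: "valid_power_system S" and v: "v \<in> carrier_vec (n_bus S * 2)"
    and i: "i \<in> carrier_vec (n_gen S * 5)"
  defines "iT \<equiv> the (mat_inverse (ZT_mat S w)) *\<^sub>v (transpose_mat (incidence2 S) *\<^sub>v v)"
  shows "network_residual S i v iT w = 0\<^sub>v (n_bus S * 2) \<longleftrightarrow>
    (stator_currents S i, v) \<in> nodal_balance S w"
proof -
  let ?n = "n_bus S * 2" and ?s = "stator_currents S i"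
  let ?c = "w \<cdot>\<^sub>v ((C_mat S * Jv_mat S) *\<^sub>v v)" and ?e = "incidence2 S *\<^sub>v iT"
  have c: "?c \<in> carrier_vec ?n"
    using mult_mat_vec_carrier[OF mult_carrier_mat[OF C_carrier[of S] Jv_carrier] v] by simp
  have e: "?e \<in> carrier_vec ?n"
    by (rule carrier_vecI) simp
  have s: "Iv_mat S *\<^sub>v i \<in> carrier_vec ?n"
    using mult_mat_vec_carrier[OF Iv_carrier[OF S] i] .
  have "(- ?s) @\<^sub>v 0\<^sub>v (2 * n_load S) = - (?s @\<^sub>v 0\<^sub>v (2 * n_load S))"
    by (rule eq_vecI) auto
  then have neg: "(- ?s) @\<^sub>v 0\<^sub>v (2 * n_load S) = - (Iv_mat S *\<^sub>v i)"
    using Iv_mult_vec[OF i] by simp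
  have "network_residual S i v iT w = 0\<^sub>v ?n \<longleftrightarrow> - (Iv_mat S *\<^sub>v i) = i_load S v + ?c + ?e"
  proof -
    have "?c $ p + (Iv_mat S *\<^sub>v i) $ p + ?e $ p + i_load S v $ p = 0 \<longleftrightarrow>
      - (Iv_mat S *\<^sub>v i) $ p = i_load S v $ p + ?c $ p + ?e $ p" for p
      by linarith
    then show ?thesis
      unfolding network_residual_def
      using carrier_vecD[OF c] carrier_vecD[OF e] carrier_vecD[OF s]
      by (simp add: vec_eq_iff del: index_mult_mat_vec dim_mult_mat_vec index_smult_vec)
  qed
  also have "\<dots> \<longleftrightarrow> (- ?s) @\<^sub>v 0\<^sub>v (2 * n_load S) = YN_mat S w v *\<^sub>v v"
    unfolding YN_mult_vec[OF S v] neg iT_def ..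
  also have "\<dots> \<longleftrightarrow> (?s, v) \<in> nodal_balance S w"
    using v stator_currents_carrier[of S i]
    by (simp add: nodal_balance_def mult.commute del: stator_currents_carrier)
  finally show ?thesis .
qed

text \<open>The line block of \<open>rho\<close> forces the line currents, and the bus block then is
  nodal balance. Nothing is divided by w, so w = 0 is covered.\<close>

lemma steady_state_nodal_balance:
  assumes S: "valid_power_system S"
    and steady: "((\<theta>, \<omega>, i, v, iT), u) \<in> steady_states S w"
  shows "(stator_currents S i, v) \<in> nodal_balance S w"
proof -
  obtain \<tau>m vf where u: "u = (\<tau>m, vf)" by (cases u)
  have c: "\<omega> \<in> carrier_vec (n_gen S)" "\<tau>m \<in> carrier_vec (n_gen S)"
    "i \<in> carrier_vec (n_gen S * 5)" "v \<in> carrier_vec (n_bus S * 2)" "iT \<in> carrier_vec (n_line S * 2)"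
    and rho: "rho S (\<theta>, \<omega>, i, v, iT) (\<tau>m, vf) w = 0\<^sub>v (rho_dim S)"
    using steady by (auto simp: steady_states_def is_state_def is_input_def u mult.commute)
  have y: "transpose_mat (incidence2 S) *\<^sub>v v \<in> carrier_vec (n_line S * 2)"
    using c(4) by (intro mult_mat_vec_carrier[of _ _ "n_bus S * 2"]) auto
  note eqs = rho[unfolded rho_eq_0_iff[OF S c(1,2)]]
  have "iT = the (mat_inverse (ZT_mat S w)) *\<^sub>v (transpose_mat (incidence2 S) *\<^sub>v v)"
    using eqs line_currents_unique[OF S c(5) y] by blast
  then show ?thesis
    using eqs network_balance_iff[OF S c(4,3), of w] by blast
qed

text \<open>Every block of \<open>rho\<close> other than the bus block has unknowns of its own:
  rotor speed, mechanical torque, machine variables and line currents. The bus block is the given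
  balance. That w is nonzero enters through \<open>machines_solvable\<close>.\<close>

lemma nodal_balance_steady_state:
  assumes S: "valid_power_system S" and w: "w \<noteq> 0" and bal: "(cur, v) \<in> nodal_balance S w"
  shows "\<exists>\<theta> \<omega> i iT u. stator_currents S i = cur \<and> ((\<theta>, \<omega>, i, v, iT), u) \<in> steady_states S w"
proof -
  have cur: "cur \<in> carrier_vec (n_gen S * 2)" and v: "v \<in> carrier_vec (n_bus S * 2)"
    using bal by (auto simp: nodal_balance_def mult.commute)
  obtain \<theta> i vf where sol: "\<theta> \<in> carrier_vec (n_gen S)" "i \<in> carrier_vec (n_gen S * 5)"
    "vf \<in> carrier_vec (n_gen S)" "stator_currents S i = cur"
    "machine_residual S \<theta> (w \<cdot>\<^sub>v vec (n_gen S) (\<lambda>_. 1)) i v vf w = 0\<^sub>v (n_gen S * 5)"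
    using machines_solvable[OF S w cur v] by metis
  define \<omega> where "\<omega> = w \<cdot>\<^sub>v vec (n_gen S) (\<lambda>_. 1)"
  define \<tau>m where "\<tau>m = D_mat S *\<^sub>v \<omega> + torque S \<theta> i"
  define iT where "iT = the (mat_inverse (ZT_mat S w)) *\<^sub>v (transpose_mat (incidence2 S) *\<^sub>v v)"
  have \<omega>: "\<omega> \<in> carrier_vec (n_gen S)" by (simp add: \<omega>_def)
  have \<tau>m: "\<tau>m \<in> carrier_vec (n_gen S)"
    unfolding \<tau>m_def by (intro add_carrier_vec mult_mat_vec_carrier[OF D_carrier] \<omega> torque_carrier)
  note c = \<omega> \<tau>m
  have y: "transpose_mat (incidence2 S) *\<^sub>v v \<in> carrier_vec (n_line S * 2)"
    using v by (intro mult_mat_vec_carrier[of _ _ "n_bus S * 2"]) auto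
  then have iT: "iT \<in> carrier_vec (n_line S * 2)"
    unfolding iT_def by (rule mult_mat_vec_carrier[OF ZT_inverse(1)[OF S]])
  have "ZT_mat S w *\<^sub>v iT - transpose_mat (incidence2 S) *\<^sub>v v = 0\<^sub>v (n_line S * 2)"
    using line_currents_unique[OF S iT y] by (simp add: iT_def)
  moreover have "network_residual S i v iT w = 0\<^sub>v (n_bus S * 2)"
    using network_balance_iff[OF S v sol(2), of w] bal by (simp add: iT_def sol(4))
  ultimately have "rho S (\<theta>, \<omega>, i, v, iT) (\<tau>m, vf) w = 0\<^sub>v (rho_dim S)"
    unfolding rho_eq_0_iff[OF S c] using sol(5) c
    by (simp add: \<omega>_def[symmetric] \<tau>m_def[symmetric])
  then have "((\<theta>, \<omega>, i, v, iT), (\<tau>m, vf)) \<in> steady_states S w"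
    using c sol v iT by (simp add: steady_states_def is_state_def is_input_def mult.commute)
  with sol(4) show ?thesis by blast
qed

text \<open>The converse is restricted to nonzero \<open>\<omega>0\<close>. At zero the stator rows
  demand that \<open>r_s\<close> times the stator current equal the voltage at every generator bus,
  which nodal balance does not imply in general.\<close>

theorem theorem7:
  fixes S :: power_system and \<omega>0 :: real
  assumes "valid_power_system S"
  shows "(\<forall>is \<in> carrier_vec (2 * n_gen S). \<forall>v \<in> carrier_vec (2 * n_bus S).
            (is, v) \<notin> nodal_balance S \<omega>0 \<longrightarrow>
            \<not> (\<exists>\<theta> \<omega> i iT u. stator_currents S i = is \<and>
                 ((\<theta>, \<omega>, i, v, iT), u) \<in> steady_states S \<omega>0)) \<and>
         (\<omega>0 \<noteq> 0 \<longrightarrow>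
           (\<forall>(is, v) \<in> nodal_balance S \<omega>0.
              \<exists>\<theta> \<omega> i iT u. stator_currents S i = is \<and>
                ((\<theta>, \<omega>, i, v, iT), u) \<in> steady_states S \<omega>0))"
  using steady_state_nodal_balance[OF assms] nodal_balance_steady_state[OF assms] by blast

end
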